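(* Let $B_1,\dots,B_n$ be independent $p\times p$ sub-Gaussian random matrices with variance proxy $\varrho^2>0$ such that the entries of each $B_i$ are independent and identically distributed with mean zero and variance $\sigma^2>0$, and let $A_i=(B_i+B_i^\top)/2$ for $i=1,\dots,n$. Let $\gamma\in(0,1/3)$. If $$n\ge\frac{4096\log(36\sqrt2/\gamma)\,\varrho^4}{\gamma^2\sigma^4}(2p+1),$$ then with probability at least $1-p_4$, where $p_4=2\exp\{-\frac{n\gamma^2\sigma^4}{4096\varrho^4}\}$, $$\frac{1-2\gamma}{2}\sigma^2\|u\|^2\|v\|^2\le\frac1n\sum_{i=1}^n\langle u,A_iv\rangle^2\le\frac{2+3\gamma}{2}\sigma^2\|u\|^2\|v\|^2\qquad\text{for all }u,v\in\mathbb{R}^p .$$ Furthermore, with the same probability, there exist two positive constants $\lambda,\eta$ such that $\lambda\|u\|^2\|v\|^2\le \frac1n\sum_{i=1}^n\langle u,A_iv\rangle^2\le \eta\|u\|^2\|v\|^2$ for all $u,v\in\mathbb{R}^p$.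
   Context: $\|\cdot\|$ is the Euclidean norm. A random variable $X$ is sub-Gaussian with variance proxy $\varrho^2$ if $\mathbb{E}X=0$ and $\mathbb{E}\exp(sX)\le\exp(\varrho^2s^2/2)$ for all $s\in\mathbb{R}$. A random matrix $X$ is sub-Gaussian with variance proxy $\varrho^2$ if $\mathbb{E}X=0$ and $\langle u,Xv\rangle$ is a sub-Gaussian random variable with variance proxy $\varrho^2$ for all unit vectors $u,v$. *)

theory Defs
  imports "HOL-Probability.Probability"
begin

text \<open>
  The argument \<open>v\<close> is the variance proxy itself (i.e. already squared).
  Integrability is demanded explicitly because the Bochner integral of a
  non-integrable function is \<open>0\<close>: the centring and the bound on the moment
  generating function are meant to include finiteness.
\<close>

definition subgaussian_var :: "'w measure \<Rightarrow> ('w \<Rightarrow> real) \<Rightarrow> real \<Rightarrow> bool" where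
  "subgaussian_var M X v \<longleftrightarrow>
     integrable M X \<and> prob_space.expectation M X = 0 \<and>
     (\<forall>s. integrable M (\<lambda>w. exp (s * X w)) \<and>
          prob_space.expectation M (\<lambda>w. exp (s * X w)) \<le> exp (v * s\<^sup>2 / 2))"

definition subgaussian_mat :: "'w measure \<Rightarrow> ('w \<Rightarrow> real^'n^'m) \<Rightarrow> real \<Rightarrow> bool" where
  "subgaussian_mat M X v \<longleftrightarrow>
     integrable M X \<and> prob_space.expectation M X = 0 \<and>
     (\<forall>(a::real^'m) (b::real^'n). norm a = 1 \<longrightarrow> norm b = 1 \<longrightarrow>
        subgaussian_var M (\<lambda>w. a \<bullet> (X w *v b)) v)"

definition iid_vars :: "'w measure \<Rightarrow> ('i \<Rightarrow> 'w \<Rightarrow> real) \<Rightarrow> 'i set \<Rightarrow> bool" where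
  "iid_vars M X I \<longleftrightarrow>
     prob_space.indep_vars M (\<lambda>_. borel) X I \<and>
     (\<forall>i\<in>I. \<forall>j\<in>I. distr M borel (X i) = distr M borel (X j))"

end

theory Submission
  imports Defs
begin

text \<open>
  For fixed vectors \<open>u\<close> and \<open>v\<close>, the number \<open>u \<bullet> (A i w *v v)\<close> is the average of \<open>u \<bullet> (B i w *v v)\<close> and
  \<open>v \<bullet> (B i w *v u)\<close>. For unit vectors it is therefore sub-Gaussian with the same variance proxy
  (\<open>subgaussian_var_average\<close>). As a linear combination of independent centred entries, its
  second moment is \<open>\<sigma>\<^sup>2 * ((norm u)\<^sup>2 * (norm v)\<^sup>2 + (u \<bullet> v)\<^sup>2) / 2\<close>
  (\<open>symmetric_part_second_moment\<close>), which by the Cauchy-Schwarz inequality is between \<open>\<sigma>\<^sup>2 / 2\<close> and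
  \<open>\<sigma>\<^sup>2\<close> for unit vectors.

  The square of a sub-Gaussian variable is sub-exponential (\<open>subgaussian_square_mgf\<close>), so the average of
  \<open>n\<close> independent squares deviates from its mean by \<open>\<gamma> * \<sigma>\<^sup>2 / 2\<close> or more with probability at
  most \<open>2 * exp (- 2 * x)\<close>, where \<open>x = n * \<gamma>\<^sup>2 * \<sigma> ^ 4 / (4096 * \<rho> ^ 4)\<close>
  (\<open>subgaussian_squares_concentration\<close>). The unit sphere has a net of mesh \<open>\<gamma> / 12\<close> with at most
  \<open>(36 * sqrt 2 / \<gamma>) ^ p\<close> points (\<open>sphere_net\<close>). The lower bound on \<open>n\<close> ensures that the union
  bound over all pairs of net points uses up only half of the exponent (\<open>net_union_bound\<close>).

  Outside this small event, the passage from the net to all vectors is deterministic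
  (\<open>bilinear_square_net_bounds\<close>): the sum of squares of bilinear forms changes between neighbouring unit
  vectors by at most a small multiple of its own maximum, so its maximum is controlled by the values
  on the net, and then so is its minimum. The mesh is such that this step and the deviation at the net
  points together stay within the relative error that the theorem permits. The constants \<open>\<lambda>\<close> and \<open>\<eta>\<close>
  of the second assertion are those of the first, which are positive because \<open>\<gamma> < 1 / 2\<close>.
\<close>

section \<open>Squares of sub-Gaussian variables\<close>

lemma nn_integral_normal_density:
  assumes "0 < \<tau>"
  shows "(\<integral>\<^sup>+x. ennreal (normal_density \<mu> \<tau> x) \<partial>lborel) = 1"
  using assms by (subst nn_integral_eq_integral) auto

text \<open>
  Completing the square turns the integrand into a multiple of the normal density with mean \<open>s\<close>.
\<close>

lemma std_normal_exp_linear: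
  "(\<integral>\<^sup>+x. ennreal (std_normal_density x * exp (s * x)) \<partial>lborel) = ennreal (exp (s\<^sup>2 / 2))"
proof -
  have eq: "std_normal_density x * exp (s * x) = exp (s\<^sup>2 / 2) * normal_density s 1 x" for x
    by (simp add: normal_density_def exp_add [symmetric] exp_minus power2_eq_square field_simps)
  show ?thesis
    by (simp add: eq ennreal_mult nn_integral_cmult nn_integral_normal_density)
qed

text \<open>
  The integrand is \<open>sqrt 2\<close> times the normal density with variance \<open>2\<close>, since
  \<open>1 / 2 - 1 / 4 = 1 / (2 * 2)\<close>.
\<close>

lemma std_normal_exp_square:
  "(\<integral>\<^sup>+x. ennreal (std_normal_density x * exp (x\<^sup>2 / 4)) \<partial>lborel) = ennreal (sqrt 2)"
proof -
  have eq: "std_normal_density x * exp (x\<^sup>2 / 4) = sqrt 2 * normal_density 0 (sqrt 2) x" for x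
    by (simp add: normal_density_def exp_add [symmetric] real_sqrt_mult field_simps)
  show ?thesis
    by (simp add: eq ennreal_mult nn_integral_cmult nn_integral_normal_density)
qed

text \<open>
  The hypothesis controls exponentials that are linear in \<open>X\<close>, the conclusion one that is quadratic.
  The link is an auxiliary standard normal variable \<open>g\<close> independent of \<open>X\<close>: for fixed \<open>w\<close>, the square is
  linearised as \<open>exp ((X w)\<^sup>2 / (4 * v)) = E exp (g * X w / sqrt (2 * v))\<close>. Exchanging the two
  expectations and using the hypothesis for fixed \<open>g\<close> leaves \<open>E exp (g\<^sup>2 / 4) = sqrt 2\<close>. All functions
  are nonnegative, so Tonelli's theorem justifies the exchange and delivers integrability as well.
\<close>

lemma subgaussian_exp_square:
  assumes "prob_space M" and X: "subgaussian_var M X v" and v: "v > 0"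
  shows "integrable M (\<lambda>w. exp ((X w)\<^sup>2 / (4 * v)))"
    and "(\<integral>w. exp ((X w)\<^sup>2 / (4 * v)) \<partial>M) \<le> sqrt 2"
proof -
  interpret prob_space M by fact
  interpret pair_sigma_finite lborel M ..
  have [measurable]: "X \<in> borel_measurable M"
    using X by (auto simp: subgaussian_var_def)
  have mgf: "(\<integral>\<^sup>+w. ennreal (exp (s * X w)) \<partial>M) \<le> ennreal (exp (v * s\<^sup>2 / 2))" for s
    using X by (subst nn_integral_eq_integral) (auto simp: subgaussian_var_def)
  have "(\<integral>\<^sup>+w. ennreal (exp ((X w)\<^sup>2 / (4 * v))) \<partial>M) =
        (\<integral>\<^sup>+w. \<integral>\<^sup>+g. ennreal (std_normal_density g * exp (X w / sqrt (2 * v) * g)) \<partial>lborel \<partial>M)"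
    using v by (subst std_normal_exp_linear) (simp add: power_divide)
  also have "\<dots> = (\<integral>\<^sup>+g. \<integral>\<^sup>+w. ennreal (std_normal_density g * exp (X w / sqrt (2 * v) * g)) \<partial>M \<partial>lborel)"
    by (rule Fubini') measurable
  also have "\<dots> = (\<integral>\<^sup>+g. ennreal (std_normal_density g) *
                    (\<integral>\<^sup>+w. ennreal (exp (g / sqrt (2 * v) * X w)) \<partial>M) \<partial>lborel)"
    by (simp add: ennreal_mult nn_integral_cmult mult.commute)
  also have "\<dots> \<le> (\<integral>\<^sup>+g. ennreal (std_normal_density g) *
                    ennreal (exp (v * (g / sqrt (2 * v))\<^sup>2 / 2)) \<partial>lborel)"
    by (intro nn_integral_mono mult_left_mono mgf) auto
  also have "\<dots> = (\<integral>\<^sup>+g. ennreal (std_normal_density g * exp (g\<^sup>2 / 4)) \<partial>lborel)"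
    using v by (simp add: ennreal_mult power_divide)
  also have "\<dots> = ennreal (sqrt 2)"
    by (rule std_normal_exp_square)
  finally have bound: "(\<integral>\<^sup>+w. ennreal (exp ((X w)\<^sup>2 / (4 * v))) \<partial>M) \<le> ennreal (sqrt 2)" .
  show int: "integrable M (\<lambda>w. exp ((X w)\<^sup>2 / (4 * v)))"
    by (rule integrableI_bounded) (use bound in \<open>auto simp: order_le_less_trans\<close>)
  show "(\<integral>w. exp ((X w)\<^sup>2 / (4 * v)) \<partial>M) \<le> sqrt 2"
    using bound by (subst (asm) nn_integral_eq_integral [OF int]) auto
qed

text \<open>
  Compared with the convexity bound \<open>1 + y \<le> exp y\<close>, the error is quadratic; taking expectations for a
  centred \<open>y\<close> removes the linear term, which is why the logarithm of a moment generating function is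
  quadratic near the origin.
\<close>

lemma exp_le_second_order:
  fixes y :: real
  shows "exp y \<le> 1 + y + y\<^sup>2 / 2 * exp \<bar>y\<bar>"
proof -
  obtain t where t: "\<bar>t\<bar> \<le> \<bar>y\<bar>" "exp y = (\<Sum>m<2. y ^ m / fact m) + exp t / fact 2 * y ^ 2"
    using Maclaurin_exp_le [of y 2] by auto
  have "exp t * y\<^sup>2 \<le> exp \<bar>y\<bar> * y\<^sup>2"
    using t(1) by (intro mult_right_mono) auto
  then show ?thesis
    using t(2) by (simp add: numeral_2_eq_2 field_simps)
qed

text \<open>
  Both facts come from \<open>1 + y \<le> exp y\<close> at \<open>y = (X w)\<^sup>2 / (4 * v)\<close>. The optimal bound on the second moment
  is \<open>v\<close>; the factor \<open>2\<close> is immediate and is absorbed by the constants below.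
\<close>

lemma subgaussian_square:
  assumes "prob_space M" and X: "subgaussian_var M X v" and v: "v > 0"
  shows subgaussian_square_integrable: "integrable M (\<lambda>w. (X w)\<^sup>2)"
    and subgaussian_second_moment: "(\<integral>w. (X w)\<^sup>2 \<partial>M) \<le> 2 * v"
proof -
  interpret prob_space M by fact
  have [measurable]: "X \<in> borel_measurable M"
    using X by (auto simp: subgaussian_var_def)
  note E = subgaussian_exp_square [OF assms]
  have le: "1 + (X w)\<^sup>2 / (4 * v) \<le> exp ((X w)\<^sup>2 / (4 * v))" for w
    by (rule exp_ge_add_one_self)
  have "integrable M (\<lambda>w. (X w)\<^sup>2 / (4 * v))"
  proof (rule Bochner_Integration.integrable_bound [OF E(1)])
    show "AE w in M. norm ((X w)\<^sup>2 / (4 * v)) \<le> norm (exp ((X w)\<^sup>2 / (4 * v)))"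
    proof (rule AE_I2)
      fix w
      show "norm ((X w)\<^sup>2 / (4 * v)) \<le> norm (exp ((X w)\<^sup>2 / (4 * v)))"
        using v by (intro order_trans [OF _ order_trans [OF le abs_ge_self, folded real_norm_def]]) auto
    qed
  qed auto
  from integrable_mult_right [OF this, of "4 * v"]
  show int: "integrable M (\<lambda>w. (X w)\<^sup>2)"
    using v by simp
  have "(\<integral>w. 1 + (X w)\<^sup>2 / (4 * v) \<partial>M) \<le> (\<integral>w. exp ((X w)\<^sup>2 / (4 * v)) \<partial>M)"
    using E(1) int by (intro integral_mono le) auto
  then have "1 + (\<integral>w. (X w)\<^sup>2 \<partial>M) / (4 * v) \<le> sqrt 2"
    using E(2) int by (simp add: prob_space)
  moreover have "sqrt 2 \<le> 3 / 2"
    by (rule real_le_lsqrt) (auto simp: power2_eq_square)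
  ultimately have "(\<integral>w. (X w)\<^sup>2 \<partial>M) / (4 * v) \<le> 1 / 2"
    by linarith
  then show "(\<integral>w. (X w)\<^sup>2 \<partial>M) \<le> 2 * v"
    using v by (simp add: field_simps)
qed

text \<open>
  Here \<open>z\<close> stands for \<open>X\<^sup>2 / v\<close> and \<open>m\<close> for its mean. The right-hand side is chosen because its expectation
  is under control: the polynomial factor costs \<open>128 * exp (z / 8)\<close>, since \<open>(z / 8)\<^sup>2 / 2 = z\<^sup>2 / 128\<close>, and the
  exponential factor costs \<open>5 / 4 * exp (z / 8)\<close>, since \<open>\<bar>l\<bar>\<close> is small.
\<close>

lemma centred_square_pointwise:
  fixes z m l :: real
  assumes "0 \<le> z" "0 \<le> m" "m \<le> 2" "\<bar>l\<bar> \<le> 1 / 16"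
  shows "(z - m)\<^sup>2 * exp (\<bar>l * (z - m)\<bar>) \<le> 160 * exp (z / 4)"
proof -
  have "\<bar>z - m\<bar> \<le> z + 2" using assms by auto
  have "(z - m)\<^sup>2 \<le> z\<^sup>2 + 4"
  proof -
    have "m\<^sup>2 \<le> 2\<^sup>2" using assms by (intro power_mono)
    moreover have "0 \<le> z * m" using assms by simp
    ultimately show ?thesis by (simp add: power2_diff)
  qed
  also have "\<dots> \<le> 128 * exp (z / 8)"
  proof -
    have "1 + z / 8 + (z / 8)\<^sup>2 / 2 \<le> exp (z / 8)"
      using assms by (intro exp_lower_Taylor_quadratic) auto
    then show ?thesis using assms by (simp add: power2_eq_square)
  qed
  finally have 1: "(z - m)\<^sup>2 \<le> 128 * exp (z / 8)" .
  have "\<bar>l * (z - m)\<bar> \<le> 1 / 16 * (z + 2)"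
    unfolding abs_mult using assms \<open>\<bar>z - m\<bar> \<le> z + 2\<close> by (intro mult_mono) auto
  also have "\<dots> \<le> 1 / 8 + z / 8" using assms by simp
  finally have 2: "exp \<bar>l * (z - m)\<bar> \<le> exp (1 / 8) * exp (z / 8)"
    by (simp add: exp_add [symmetric])
  have "exp (1 / 8 :: real) \<le> 1 + 1 / 8 + (1 / 8)\<^sup>2"
    by (rule exp_bound) auto
  then have 3: "exp (1 / 8 :: real) \<le> 5 / 4"
    by (simp add: power2_eq_square)
  have "(z - m)\<^sup>2 * exp (\<bar>l * (z - m)\<bar>) \<le> (128 * exp (z / 8)) * (exp (1 / 8) * exp (z / 8))"
    by (intro mult_mono 1 2) auto
  also have "\<dots> = 128 * exp (1 / 8) * exp (z / 4)"
    by (simp add: exp_add [symmetric])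
  also have "\<dots> \<le> 128 * (5 / 4) * exp (z / 4)"
    by (intro mult_mono 3) auto
  finally show ?thesis by simp
qed

text \<open>
  The square of a sub-Gaussian variable, once centred, is sub-exponential: near the origin its moment
  generating function is that of a Gaussian with variance \<open>256 * v\<^sup>2\<close>. The second-order bound on the
  exponential reduces this to the expectation of \<open>exp ((X w)\<^sup>2 / (4 * v))\<close>.
\<close>

lemma subgaussian_square_mgf:
  assumes "prob_space M" and X: "subgaussian_var M X v" and v: "v > 0"
    and l: "\<bar>l\<bar> \<le> 1 / (16 * v)"
  defines "\<mu> \<equiv> (\<integral>w. (X w)\<^sup>2 \<partial>M)"
  shows "integrable M (\<lambda>w. exp (l * ((X w)\<^sup>2 - \<mu>)))"
    and "(\<integral>w. exp (l * ((X w)\<^sup>2 - \<mu>)) \<partial>M) \<le> exp (128 * l\<^sup>2 * v\<^sup>2)"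
proof -
  interpret prob_space M by fact
  have [measurable]: "X \<in> borel_measurable M"
    using X by (auto simp: subgaussian_var_def)
  note E = subgaussian_exp_square [OF assms(1-3)]
  have int2: "integrable M (\<lambda>w. (X w)\<^sup>2)" and mu: "0 \<le> \<mu>" "\<mu> \<le> 2 * v"
    using subgaussian_square [OF assms(1-3)] by (auto simp: \<mu>_def)
  define g where "g = (\<lambda>w. 1 + l * ((X w)\<^sup>2 - \<mu>) + 80 * (l * v)\<^sup>2 * exp ((X w)\<^sup>2 / (4 * v)))"
  have le: "exp (l * ((X w)\<^sup>2 - \<mu>)) \<le> g w" for w
  proof -
    define z m where "z = (X w)\<^sup>2 / v" and "m = \<mu> / v"
    have *: "l * ((X w)\<^sup>2 - \<mu>) = l * v * (z - m)"
      using v by (simp add: z_def m_def field_simps)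
    have "(z - m)\<^sup>2 * exp (\<bar>l * v * (z - m)\<bar>) \<le> 160 * exp (z / 4)"
      using v mu l by (intro centred_square_pointwise) (auto simp: z_def m_def field_simps abs_mult)
    then have "(l * v)\<^sup>2 * ((z - m)\<^sup>2 * exp (\<bar>l * v * (z - m)\<bar>)) \<le> (l * v)\<^sup>2 * (160 * exp (z / 4))"
      by (rule mult_left_mono) auto
    moreover have "exp (l * v * (z - m)) \<le>
        1 + l * v * (z - m) + (l * v * (z - m))\<^sup>2 / 2 * exp \<bar>l * v * (z - m)\<bar>"
      by (rule exp_le_second_order)
    ultimately have "exp (l * v * (z - m)) \<le> 1 + l * v * (z - m) + 80 * (l * v)\<^sup>2 * exp (z / 4)"
      by (simp add: power_mult_distrib mult.assoc)
    then show ?thesis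
      unfolding g_def * by (simp add: z_def mult.commute)
  qed
  have int_g: "integrable M g"
    unfolding g_def using int2 E(1) by auto
  show int: "integrable M (\<lambda>w. exp (l * ((X w)\<^sup>2 - \<mu>)))"
    by (rule Bochner_Integration.integrable_bound [OF int_g])
       (use le in \<open>auto intro: order_trans [OF _ abs_ge_self]\<close>)
  have "(\<integral>w. exp (l * ((X w)\<^sup>2 - \<mu>)) \<partial>M) \<le> (\<integral>w. g w \<partial>M)"
    by (intro integral_mono int int_g le)
  also have "\<dots> = 1 + 80 * (l * v)\<^sup>2 * (\<integral>w. exp ((X w)\<^sup>2 / (4 * v)) \<partial>M)"
    unfolding g_def using int2 E(1) by (simp add: prob_space \<mu>_def)
  also have "\<dots> \<le> 1 + 80 * (l * v)\<^sup>2 * (8 / 5)"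
  proof -
    have "sqrt 2 \<le> 8 / 5"
      by (rule real_le_lsqrt) (auto simp: power2_eq_square)
    then show ?thesis
      using E(2) by (intro add_left_mono mult_left_mono) auto
  qed
  also have "\<dots> = 1 + 128 * l\<^sup>2 * v\<^sup>2"
    by (simp add: power_mult_distrib)
  also have "\<dots> \<le> exp (128 * l\<^sup>2 * v\<^sup>2)"
    by (rule exp_ge_add_one_self)
  finally show "(\<integral>w. exp (l * ((X w)\<^sup>2 - \<mu>)) \<partial>M) \<le> exp (128 * l\<^sup>2 * v\<^sup>2)" .
qed

text \<open>
  Whatever the joint distribution, the inequality of the arithmetic and geometric means bounds the
  moment generating function of the average by the average of the two, taken at the same argument.
  This is what makes symmetrising a matrix harmless for its variance proxy.
\<close>

lemma subgaussian_var_average: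
  assumes X: "subgaussian_var M X v" and Y: "subgaussian_var M Y v"
  shows "subgaussian_var M (\<lambda>w. (X w + Y w) / 2) v"
  unfolding subgaussian_var_def
proof (intro conjI allI)
  note XY = X [unfolded subgaussian_var_def] Y [unfolded subgaussian_var_def]
  have [measurable]: "X \<in> borel_measurable M" "Y \<in> borel_measurable M"
    using XY by auto
  show "integrable M (\<lambda>w. (X w + Y w) / 2)" "(\<integral>w. (X w + Y w) / 2 \<partial>M) = 0"
    using XY by auto
  fix s :: real
  have eX: "integrable M (\<lambda>w. exp (s * X w))" "(\<integral>w. exp (s * X w) \<partial>M) \<le> exp (v * s\<^sup>2 / 2)"
    and eY: "integrable M (\<lambda>w. exp (s * Y w))" "(\<integral>w. exp (s * Y w) \<partial>M) \<le> exp (v * s\<^sup>2 / 2)"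
    using XY by auto
  have le: "exp (s * ((X w + Y w) / 2)) \<le> (exp (s * X w) + exp (s * Y w)) / 2" for w
  proof -
    have "exp (s * ((X w + Y w) / 2)) = exp (s * X w / 2) * exp (s * Y w / 2)"
      by (simp add: exp_add [symmetric] algebra_simps add_divide_distrib)
    also have "\<dots> \<le> ((exp (s * X w / 2))\<^sup>2 + (exp (s * Y w / 2))\<^sup>2) / 2"
      using sum_squares_bound [of "exp (s * X w / 2)" "exp (s * Y w / 2)"] by simp
    also have "\<dots> = (exp (s * X w) + exp (s * Y w)) / 2"
      by (simp add: exp_double [symmetric])
    finally show ?thesis .
  qed
  have int: "integrable M (\<lambda>w. (exp (s * X w) + exp (s * Y w)) / 2)"
    using eX(1) eY(1) by auto
  show int': "integrable M (\<lambda>w. exp (s * ((X w + Y w) / 2)))"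
    by (rule Bochner_Integration.integrable_bound [OF int])
       (use le in \<open>auto intro: order_trans [OF _ abs_ge_self]\<close>)
  have "(\<integral>w. exp (s * ((X w + Y w) / 2)) \<partial>M) \<le> (\<integral>w. (exp (s * X w) + exp (s * Y w)) / 2 \<partial>M)"
    by (intro integral_mono int int' le)
  also have "\<dots> \<le> exp (v * s\<^sup>2 / 2)"
    using eX eY by simp
  finally show "(\<integral>w. exp (s * ((X w + Y w) / 2)) \<partial>M) \<le> exp (v * s\<^sup>2 / 2)" .
qed

section \<open>Concentration of averages of squares\<close>

text \<open>
  Chernoff's method; the sign \<open>c\<close> serves both tails at once. The exponent
  \<open>n * (128 * l\<^sup>2 * v\<^sup>2 - l * t)\<close> is minimal at \<open>l = t / (256 * v\<^sup>2)\<close>, and \<open>t \<le> 16 * v\<close> keeps this \<open>l\<close>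
  in the range where the moment generating function is controlled.
\<close>

lemma subgaussian_squares_one_sided:
  fixes X :: "'i \<Rightarrow> 'w \<Rightarrow> real"
  assumes "prob_space M" and "finite I"
    and indep: "prob_space.indep_vars M (\<lambda>_. borel) X I"
    and X: "\<And>i. i \<in> I \<Longrightarrow> subgaussian_var M (X i) v" and v: "v > 0"
    and mu: "\<And>i. i \<in> I \<Longrightarrow> (\<integral>w. (X i w)\<^sup>2 \<partial>M) = \<mu>"
    and t: "0 \<le> t" "t \<le> 16 * v" and c: "\<bar>c\<bar> = 1"
  shows "measure M {w \<in> space M. c * (\<Sum>i\<in>I. (X i w)\<^sup>2 - \<mu>) \<ge> real (card I) * t}
           \<le> exp (- (real (card I) * t\<^sup>2 / (512 * v\<^sup>2)))"
proof -
  interpret prob_space M by fact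
  define n where "n = real (card I)"
  define l where "l = t / (256 * v\<^sup>2)"
  have c2: "c\<^sup>2 = 1" using c by (metis power2_abs power_one)
  have l0: "l \<ge> 0" using t by (simp add: l_def)
  have l: "\<bar>c * l\<bar> \<le> 1 / (16 * v)"
    unfolding abs_mult c using l0 t v by (simp add: l_def power2_eq_square field_simps)
  have meas [measurable]: "X i \<in> borel_measurable M" if "i \<in> I" for i
    using X [OF that] by (auto simp: subgaussian_var_def)
  define Y where "Y = (\<lambda>i w. exp (c * l * ((X i w)\<^sup>2 - \<mu>)))"
  have Y: "integrable M (Y i)" "(\<integral>w. Y i w \<partial>M) \<le> exp (128 * l\<^sup>2 * v\<^sup>2)" if "i \<in> I" for i
    using subgaussian_square_mgf [OF \<open>prob_space M\<close> X [OF that] v l] mu [OF that] c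
    by (auto simp: Y_def power_mult_distrib c2)
  have indY: "indep_vars (\<lambda>_. borel) Y I"
    unfolding Y_def by (rule indep_vars_compose2 [OF indep]) auto
  have prod: "(\<Prod>i\<in>I. Y i w) = exp (l * (c * (\<Sum>i\<in>I. (X i w)\<^sup>2 - \<mu>)))" for w
    using \<open>finite I\<close> by (simp add: Y_def exp_sum [symmetric] sum_distrib_left mult.assoc mult.left_commute)
  have pos: "0 \<le> (\<Prod>i\<in>I. Y i w)" for w
    by (simp add: prod)
  have "measure M {w \<in> space M. c * (\<Sum>i\<in>I. (X i w)\<^sup>2 - \<mu>) \<ge> n * t}
        \<le> measure M {w \<in> space M. (\<Prod>i\<in>I. Y i w) \<ge> exp (l * (n * t))}"
    using l0 by (intro finite_measure_mono) (auto simp: prod intro!: mult_left_mono)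
  also have "\<dots> \<le> (\<integral>w. (\<Prod>i\<in>I. Y i w) \<partial>M) / exp (l * (n * t))"
    by (rule integral_Markov_inequality_measure [where A = "{}"])
       (auto intro!: indep_vars_integrable \<open>finite I\<close> indY Y pos)
  also have "(\<integral>w. (\<Prod>i\<in>I. Y i w) \<partial>M) = (\<Prod>i\<in>I. \<integral>w. Y i w \<partial>M)"
    by (intro indep_vars_lebesgue_integral \<open>finite I\<close> indY Y)
  also have "(\<Prod>i\<in>I. \<integral>w. Y i w \<partial>M) \<le> (\<Prod>i\<in>I. exp (128 * l\<^sup>2 * v\<^sup>2))"
    by (intro prod_mono conjI Y integral_nonneg_AE) (auto simp: Y_def)
  also have "\<dots> = exp (n * (128 * l\<^sup>2 * v\<^sup>2))"
    by (simp add: n_def exp_of_nat_mult)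
  also have "exp (n * (128 * l\<^sup>2 * v\<^sup>2)) / exp (l * (n * t)) = exp (- (n * t\<^sup>2 / (512 * v\<^sup>2)))"
    unfolding exp_diff [symmetric] l_def using v
    by (intro arg_cong [of _ _ exp]) (simp add: field_simps power2_eq_square)
  finally show ?thesis by (simp add: n_def divide_right_mono)
qed

lemma subgaussian_squares_concentration:
  fixes X :: "'i \<Rightarrow> 'w \<Rightarrow> real"
  assumes "prob_space M" and "finite I"
    and indep: "prob_space.indep_vars M (\<lambda>_. borel) X I"
    and X: "\<And>i. i \<in> I \<Longrightarrow> subgaussian_var M (X i) v" and v: "v > 0"
    and mu: "\<And>i. i \<in> I \<Longrightarrow> (\<integral>w. (X i w)\<^sup>2 \<partial>M) = \<mu>"
    and t: "0 \<le> t" "t \<le> 16 * v"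
  shows "measure M {w \<in> space M. \<bar>(\<Sum>i\<in>I. (X i w)\<^sup>2) - real (card I) * \<mu>\<bar> \<ge> real (card I) * t}
           \<le> 2 * exp (- (real (card I) * t\<^sup>2 / (512 * v\<^sup>2)))"
proof -
  interpret prob_space M by fact
  have meas [measurable]: "X i \<in> borel_measurable M" if "i \<in> I" for i
    using X [OF that] by (auto simp: subgaussian_var_def)
  define E where "E = (\<lambda>c. {w \<in> space M. c * (\<Sum>i\<in>I. (X i w)\<^sup>2 - \<mu>) \<ge> real (card I) * t})"
  have [measurable]: "E c \<in> sets M" for c unfolding E_def by measurable
  have "{w \<in> space M. \<bar>(\<Sum>i\<in>I. (X i w)\<^sup>2) - real (card I) * \<mu>\<bar> \<ge> real (card I) * t} = E 1 \<union> E (-1)"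
    by (auto simp: E_def sum_subtractf abs_if)
  then have "measure M {w \<in> space M. \<bar>(\<Sum>i\<in>I. (X i w)\<^sup>2) - real (card I) * \<mu>\<bar> \<ge> real (card I) * t}
      \<le> measure M (E 1) + measure M (E (-1))"
    by (simp add: measure_Un_le)
  also have "\<dots> \<le> 2 * exp (- (real (card I) * t\<^sup>2 / (512 * v\<^sup>2)))"
    using subgaussian_squares_one_sided [OF assms, of 1]
      subgaussian_squares_one_sided [OF assms, of "-1"] by (simp add: E_def)
  finally show ?thesis .
qed

section \<open>The second moment of a symmetrised bilinear form\<close>

text \<open>
  Expanding the square, the mixed terms vanish because distinct factors are independent and centred.
\<close>

lemma second_moment_indep_sum:
  fixes Z :: "'e \<Rightarrow> 'w \<Rightarrow> real" and c :: "'e \<Rightarrow> real"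
  assumes "prob_space M" and "finite E"
    and indep: "prob_space.indep_vars M (\<lambda>_. borel) Z E"
    and int: "\<And>e. e \<in> E \<Longrightarrow> integrable M (Z e)" "\<And>e. e \<in> E \<Longrightarrow> integrable M (\<lambda>w. (Z e w)\<^sup>2)"
    and mean: "\<And>e. e \<in> E \<Longrightarrow> (\<integral>w. Z e w \<partial>M) = 0"
    and var: "\<And>e. e \<in> E \<Longrightarrow> (\<integral>w. (Z e w)\<^sup>2 \<partial>M) = s"
  shows "(\<integral>w. (\<Sum>e\<in>E. c e * Z e w)\<^sup>2 \<partial>M) = s * (\<Sum>e\<in>E. (c e)\<^sup>2)"
proof -
  interpret prob_space M by fact
  have cross: "integrable M (\<lambda>w. Z e w * Z e' w) \<and>
      (\<integral>w. Z e w * Z e' w \<partial>M) = (if e = e' then s else 0)" if "e \<in> E" "e' \<in> E" for e e'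
  proof (cases "e = e'")
    case True
    then show ?thesis using int(2) [OF that(1)] var [OF that(1)] by (simp add: power2_eq_square)
  next
    case False
    have ind: "indep_vars (\<lambda>_. borel) Z {e, e'}"
      using that by (intro indep_vars_subset [OF indep]) auto
    have "integrable M (\<lambda>w. \<Prod>x\<in>{e, e'}. Z x w)"
      by (rule indep_vars_integrable) (use ind int(1) that in auto)
    moreover have "(\<integral>w. (\<Prod>x\<in>{e, e'}. Z x w) \<partial>M) = (\<Prod>x\<in>{e, e'}. \<integral>w. Z x w \<partial>M)"
      by (rule indep_vars_lebesgue_integral) (use ind int(1) that in auto)
    ultimately show ?thesis using False mean that by simp
  qed
  have "(\<integral>w. (\<Sum>e\<in>E. c e * Z e w)\<^sup>2 \<partial>M) =
        (\<integral>w. (\<Sum>e\<in>E. \<Sum>e'\<in>E. c e * c e' * (Z e w * Z e' w)) \<partial>M)"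
    by (simp add: power2_eq_square sum_product mult.assoc mult.left_commute)
  also have "\<dots> = (\<Sum>e\<in>E. \<Sum>e'\<in>E. c e * c e' * (\<integral>w. Z e w * Z e' w \<partial>M))"
    using cross by (simp add: Bochner_Integration.integral_sum)
  also have "\<dots> = (\<Sum>e\<in>E. \<Sum>e'\<in>E. if e = e' then s * (c e)\<^sup>2 else 0)"
    using cross by (intro sum.cong refl) (auto simp: power2_eq_square)
  also have "\<dots> = s * (\<Sum>e\<in>E. (c e)\<^sup>2)"
    using \<open>finite E\<close> by (simp add: sum_distrib_left)
  finally show ?thesis .
qed

lemma bilinear_form_matrix:
  fixes X :: "real^'p^'p"
  shows "u \<bullet> (X *v v) = (\<Sum>(j, k)\<in>UNIV. (u $ j * v $ k) * X $ j $ k)"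
  by (simp add: inner_vec_def matrix_vector_mult_def sum_distrib_left mult.assoc mult.commute mult.left_commute
      sum.cartesian_product flip: UNIV_Times_UNIV)

text \<open>
  The left-hand side is the squared Frobenius norm of the symmetric part of the outer product of
  \<open>u\<close> and \<open>v\<close>. It lies between one half and all of \<open>(norm u)\<^sup>2 * (norm v)\<^sup>2\<close>, which is the origin of the
  gap between the two constants in the theorem.
\<close>

lemma symmetrised_tensor_norm:
  fixes u v :: "real^'p"
  shows "(\<Sum>(j, k)\<in>UNIV. ((u $ j * v $ k + v $ j * u $ k) / 2)\<^sup>2) =
     ((norm u)\<^sup>2 * (norm v)\<^sup>2 + (u \<bullet> v)\<^sup>2) / 2"
proof -
  have split: "((a * b + c * d) / 2)\<^sup>2 = (a * a) * (b * b) / 4 + (c * c) * (d * d) / 4 + (a * c) * (d * b) / 2"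
    for a b c d :: real by (simp add: power2_eq_square algebra_simps add_divide_distrib)
  show ?thesis
    unfolding UNIV_Times_UNIV [symmetric] sum.cartesian_product [symmetric] split power2_norm_eq_inner
    by (simp add: inner_vec_def sum.distrib sum_distrib_left [symmetric] sum_distrib_right [symmetric]
        sum_divide_distrib [symmetric] power2_eq_square mult.commute)
qed

lemma bounded_bilinear_matrix_form:
  fixes X :: "real^'n^'m"
  shows "bounded_bilinear (\<lambda>u v. u \<bullet> (X *v v))"
  using bounded_bilinear.comp [OF bounded_bilinear_inner bounded_linear_ident matrix_vector_mul_bounded_linear [of X]]
  by simp

lemma symmetric_part_form:
  fixes X :: "real^'p^'p"
  shows "u \<bullet> (((1 / 2) *\<^sub>R (X + transpose X)) *v v) = (u \<bullet> (X *v v) + v \<bullet> (X *v u)) / 2"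
proof -
  have "u \<bullet> (transpose X *v v) = v \<bullet> (X *v u)"
    by (metis dot_lmul_matrix inner_commute transpose_matrix_vector)
  then show ?thesis
    by (simp add: scaleR_matrix_vector_assoc [symmetric] matrix_vector_mult_add_rdistrib inner_add_right)
qed

text \<open>
  The form is a linear combination of the independent entries of \<open>X\<close>, with the entries of the symmetrised
  outer product of \<open>a\<close> and \<open>b\<close> as coefficients. Evaluating \<open>X\<close> at pairs of coordinate vectors shows that
  each entry is sub-Gaussian, hence square-integrable.
\<close>

lemma symmetric_part_second_moment:
  fixes X :: "'w \<Rightarrow> real^'p^'p"
  assumes M: "prob_space M" and X: "subgaussian_mat M X v" and v: "v > 0"
    and iid: "iid_vars M (\<lambda>(j, k) w. X w $ j $ k) UNIV"
    and var: "\<And>j k. prob_space.variance M (\<lambda>w. X w $ j $ k) = s"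
    and mean: "\<And>j k. prob_space.expectation M (\<lambda>w. X w $ j $ k) = 0"
  shows "(\<integral>w. ((a \<bullet> (X w *v b) + b \<bullet> (X w *v a)) / 2)\<^sup>2 \<partial>M) =
           s * ((norm a)\<^sup>2 * (norm b)\<^sup>2 + (a \<bullet> b)\<^sup>2) / 2"
proof -
  define Z where "Z = (\<lambda>(j, k) w. X w $ j $ k)"
  define c where "c = (\<lambda>(j, k). (a $ j * b $ k + b $ j * a $ k) / 2)"
  have sg: "subgaussian_var M (Z e) v" for e
  proof -
    obtain j k where e: "e = (j, k)" by fastforce
    have "axis j 1 \<bullet> (X w *v axis k 1) = Z e w" for w
      by (simp add: e Z_def inner_axis' matrix_vector_mul_component inner_axis)
    moreover have "subgaussian_var M (\<lambda>w. axis j 1 \<bullet> (X w *v axis k 1)) v"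
      using X unfolding subgaussian_mat_def by simp
    ultimately show ?thesis by simp
  qed
  have "(a \<bullet> (X w *v b) + b \<bullet> (X w *v a)) / 2 = (\<Sum>e\<in>UNIV. c e * Z e w)" for w
    unfolding bilinear_form_matrix sum.distrib [symmetric] sum_divide_distrib
    by (intro sum.cong refl) (auto simp: c_def Z_def field_simps)
  then have "(\<integral>w. ((a \<bullet> (X w *v b) + b \<bullet> (X w *v a)) / 2)\<^sup>2 \<partial>M) = (\<integral>w. (\<Sum>e\<in>UNIV. c e * Z e w)\<^sup>2 \<partial>M)"
    by simp
  also have "\<dots> = s * (\<Sum>e\<in>UNIV. (c e)\<^sup>2)"
  proof (rule second_moment_indep_sum [OF M])
    show "prob_space.indep_vars M (\<lambda>_. borel) Z UNIV"
      using iid by (simp add: iid_vars_def Z_def)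
    show "integrable M (Z e)" for e using sg [of e] by (simp add: subgaussian_var_def)
    show "integrable M (\<lambda>w. (Z e w)\<^sup>2)" for e by (rule subgaussian_square_integrable [OF M sg v])
    show "(\<integral>w. Z e w \<partial>M) = 0" for e using sg [of e] by (simp add: subgaussian_var_def)
    show "(\<integral>w. (Z e w)\<^sup>2 \<partial>M) = s" for e
      using var mean by (cases e) (auto simp: Z_def)
  qed auto
  also have "(\<Sum>e\<in>UNIV. (c e)\<^sup>2) = ((norm a)\<^sup>2 * (norm b)\<^sup>2 + (a \<bullet> b)\<^sup>2) / 2"
    unfolding symmetrised_tensor_norm [symmetric] by (intro sum.cong) (auto simp: c_def)
  finally show ?thesis by simp
qed

section \<open>Nets of the unit sphere\<close>

text \<open>
  Balls of radius \<open>\<epsilon> / 2\<close> around the points of \<open>N\<close> are disjoint and lie in the ball of radius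
  \<open>1 + \<epsilon> / 2\<close>, so the number of points is at most the ratio of the volumes.
\<close>

lemma separated_subset_sphere_card_le:
  fixes N :: "'a::euclidean_space set"
  assumes "finite N" and N: "N \<subseteq> sphere 0 1" and \<epsilon>: "\<epsilon> > 0"
    and sep: "\<And>x y. x \<in> N \<Longrightarrow> y \<in> N \<Longrightarrow> x \<noteq> y \<Longrightarrow> \<epsilon> < dist x y"
  shows "real (card N) \<le> (1 + 2 / \<epsilon>) ^ DIM('a)"
proof -
  define V where "V = unit_ball_vol (real DIM('a))"
  have V: "V > 0" by (simp add: V_def)
  have disj: "disjoint_family_on (\<lambda>x. ball x (\<epsilon> / 2)) N"
    unfolding disjoint_family_on_def
  proof (intro ballI impI)
    fix x y assume "x \<in> N" "y \<in> N" "x \<noteq> y"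
    then show "ball x (\<epsilon> / 2) \<inter> ball y (\<epsilon> / 2) = {}"
      using sep [of x y] by (intro disjoint_ballI) auto
  qed
  have sub: "(\<Union>x\<in>N. ball x (\<epsilon> / 2)) \<subseteq> ball 0 (1 + \<epsilon> / 2)"
  proof
    fix y assume "y \<in> (\<Union>x\<in>N. ball x (\<epsilon> / 2))"
    then obtain x where "x \<in> N" "dist x y < \<epsilon> / 2" by auto
    moreover have "norm x = 1" using \<open>x \<in> N\<close> N by auto
    moreover have "norm y \<le> norm x + dist x y"
      by (metis dist_norm norm_minus_commute norm_triangle_sub)
    ultimately show "y \<in> ball 0 (1 + \<epsilon> / 2)" by simp
  qed
  have "real (card N) * (V * (\<epsilon> / 2) ^ DIM('a)) = (\<Sum>x\<in>N. measure lborel (ball x (\<epsilon> / 2)))"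
    using \<epsilon> by (simp add: content_ball V_def)
  also have "\<dots> = measure lborel (\<Union>x\<in>N. ball x (\<epsilon> / 2))"
    using \<open>finite N\<close> disj
    by (intro measure_finite_Union [symmetric]) (use less_imp_neq [OF emeasure_lborel_ball_finite] in auto)
  also have "\<dots> \<le> measure lborel (ball (0::'a) (1 + \<epsilon> / 2))"
  proof (rule measure_mono_fmeasurable [OF sub])
    show "(\<Union>x\<in>N. ball x (\<epsilon> / 2)) \<in> sets lborel"
      by (simp add: open_UN)
    show "ball (0::'a) (1 + \<epsilon> / 2) \<in> fmeasurable lborel"
      by (rule fmeasurableI) (use emeasure_lborel_ball_finite in auto)
  qed
  also have "\<dots> = V * (1 + \<epsilon> / 2) ^ DIM('a)"
    using \<epsilon> by (simp add: content_ball V_def)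
  finally have "real (card N) * (\<epsilon> / 2) ^ DIM('a) \<le> (1 + \<epsilon> / 2) ^ DIM('a)"
    using V by (simp add: field_simps)
  then have "real (card N) \<le> ((1 + \<epsilon> / 2) / (\<epsilon> / 2)) ^ DIM('a)"
    unfolding power_divide [of "1 + \<epsilon> / 2" "\<epsilon> / 2"]
    using \<epsilon> by (subst pos_le_divide_eq) auto
  also have "(1 + \<epsilon> / 2) / (\<epsilon> / 2) = 1 + 2 / \<epsilon>"
    using \<epsilon> by (simp add: field_simps)
  finally show ?thesis .
qed

definition finite_net :: "real \<Rightarrow> 'a::metric_space set \<Rightarrow> 'a set \<Rightarrow> bool" where
  "finite_net \<epsilon> S N \<longleftrightarrow> finite N \<and> N \<subseteq> S \<and> (\<forall>x\<in>S. \<exists>y\<in>N. dist x y \<le> \<epsilon>)"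

text \<open>
  A separated set of maximal cardinality is a net: a point of the sphere far from all its members could
  be added. The volume bound guarantees that a maximal cardinality exists.
\<close>

lemma sphere_net:
  fixes \<epsilon> :: real
  assumes \<epsilon>: "\<epsilon> > 0"
  obtains N :: "'a::euclidean_space set"
    where "finite_net \<epsilon> (sphere 0 1) N" "real (card N) \<le> (1 + 2 / \<epsilon>) ^ DIM('a)"
proof -
  define separated where "separated N \<longleftrightarrow> finite N \<and> N \<subseteq> sphere (0::'a) 1 \<and>
    (\<forall>x\<in>N. \<forall>y\<in>N. x \<noteq> y \<longrightarrow> \<epsilon> < dist x y)" for N
  have bound: "real (card N) \<le> (1 + 2 / \<epsilon>) ^ DIM('a)" if "separated N" for N
    using that \<epsilon> by (intro separated_subset_sphere_card_le) (auto simp: separated_def)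
  have "separated {}" by (simp add: separated_def)
  moreover have "card N < Suc (nat \<lfloor>(1 + 2 / \<epsilon>) ^ DIM('a)\<rfloor>)" if "separated N" for N
    using bound [OF that] by (simp add: le_nat_floor less_Suc_eq_le)
  ultimately obtain N where N: "separated N" and max: "\<And>N'. separated N' \<Longrightarrow> card N' \<le> card N"
    using ex_has_greatest_nat [of separated "{}" card] by blast
  have "\<exists>y\<in>N. dist x y \<le> \<epsilon>" if x: "x \<in> sphere 0 1" for x
  proof (rule ccontr)
    assume "\<not> ?thesis"
    then have far: "\<epsilon> < dist x y" if "y \<in> N" for y using that by force
    then have "x \<notin> N" using \<epsilon> by force
    have "separated (insert x N)"
      using N x far by (auto simp: separated_def dist_commute)
    from max [OF this] show False
      using N \<open>x \<notin> N\<close> by (simp add: separated_def)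
  qed
  with N bound [OF N] show ?thesis
    by (intro that [of N]) (auto simp: finite_net_def separated_def)
qed

section \<open>From a net to all vectors\<close>

text \<open>
  Factoring \<open>(f i u v)\<^sup>2 - (f i u' v)\<^sup>2\<close> as \<open>f i (u - u') v * f i (u + u') v\<close> expresses the variation of
  \<open>Q\<close> through \<open>Q\<close> itself, at the small vector \<open>u - u'\<close> and at \<open>u + u'\<close> of norm at most \<open>2\<close>.
  Both values are controlled by \<open>K\<close>, so the estimate scales with the size of \<open>Q\<close>.
\<close>

lemma bilinear_square_diff_left:
  fixes I :: "'i set" and f :: "'i \<Rightarrow> 'a::real_normed_vector \<Rightarrow> 'b::real_normed_vector \<Rightarrow> real"
  defines "Q \<equiv> \<lambda>u v. \<Sum>i\<in>I. (f i u v)\<^sup>2"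
  assumes bil: "\<And>i. i \<in> I \<Longrightarrow> bounded_bilinear (f i)"
    and K: "\<And>u v. Q u v \<le> K * (norm u)\<^sup>2 * (norm v)\<^sup>2" and "0 \<le> K"
    and "norm u = 1" "norm u' = 1" "norm v = 1" "dist u u' \<le> \<epsilon>" "0 < \<epsilon>"
  shows "\<bar>Q u v - Q u' v\<bar> \<le> 2 * \<epsilon> * K"
proof -
  \<comment> \<open>The weights balance the two factors: \<open>Q (u - u') v\<close> is of order \<open>\<epsilon>\<^sup>2\<close> and \<open>Q (u + u') v\<close> of order \<open>4\<close>.\<close>
  have AMGM: "\<bar>a * b\<bar> \<le> a\<^sup>2 / \<epsilon> + \<epsilon> * b\<^sup>2 / 4" for a b :: real
  proof -
    have "0 \<le> (\<bar>a\<bar> - \<epsilon> * \<bar>b\<bar> / 2)\<^sup>2" by simp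
    then have "\<epsilon> * \<bar>a * b\<bar> \<le> a\<^sup>2 + \<epsilon>\<^sup>2 * b\<^sup>2 / 4"
      by (simp add: power2_diff abs_mult field_simps)
    then show ?thesis using \<open>0 < \<epsilon>\<close> by (simp add: field_simps power2_eq_square)
  qed
  have "\<bar>Q u v - Q u' v\<bar> \<le> (\<Sum>i\<in>I. \<bar>(f i u v)\<^sup>2 - (f i u' v)\<^sup>2\<bar>)"
    unfolding Q_def sum_subtractf [symmetric] by (rule sum_abs)
  also have "\<dots> \<le> (\<Sum>i\<in>I. (f i (u - u') v)\<^sup>2 / \<epsilon> + \<epsilon> * (f i (u + u') v)\<^sup>2 / 4)"
  proof (rule sum_mono)
    fix i assume i: "i \<in> I"
    have "(f i u v)\<^sup>2 - (f i u' v)\<^sup>2 = f i (u - u') v * f i (u + u') v"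
      using bil [OF i] by (simp add: bounded_bilinear.diff_left bounded_bilinear.add_left
        power2_eq_square algebra_simps)
    then show "\<bar>(f i u v)\<^sup>2 - (f i u' v)\<^sup>2\<bar> \<le> (f i (u - u') v)\<^sup>2 / \<epsilon> + \<epsilon> * (f i (u + u') v)\<^sup>2 / 4"
      using AMGM by presburger
  qed
  also have "\<dots> = Q (u - u') v / \<epsilon> + \<epsilon> * Q (u + u') v / 4"
    by (simp add: Q_def sum.distrib sum_divide_distrib sum_distrib_left)
  also have "\<dots> \<le> K * \<epsilon>\<^sup>2 / \<epsilon> + \<epsilon> * (K * 2\<^sup>2) / 4"
  proof (intro add_mono divide_right_mono mult_left_mono)
    have "norm (u - u') \<le> \<epsilon>" using assms by (simp add: dist_norm)
    then have "K * (norm (u - u'))\<^sup>2 \<le> K * \<epsilon>\<^sup>2"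
      using \<open>0 \<le> K\<close> by (intro mult_left_mono power_mono) auto
    then show "Q (u - u') v \<le> K * \<epsilon>\<^sup>2" using K [of "u - u'" v] assms by simp
    have "norm (u + u') \<le> 2" using norm_triangle_ineq [of u u'] assms by simp
    then have "K * (norm (u + u'))\<^sup>2 \<le> K * 2\<^sup>2"
      using \<open>0 \<le> K\<close> by (intro mult_left_mono power_mono) auto
    then show "Q (u + u') v \<le> K * 2\<^sup>2" using K [of "u + u'" v] assms by simp
  qed (use assms in auto)
  also have "\<dots> = 2 * \<epsilon> * K" using \<open>0 < \<epsilon>\<close> by (simp add: power2_eq_square)
  finally show ?thesis .
qed

lemma bilinear_square_diff:
  fixes I :: "'i set" and f :: "'i \<Rightarrow> 'a::real_normed_vector \<Rightarrow> 'b::real_normed_vector \<Rightarrow> real"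
  defines "Q \<equiv> \<lambda>u v. \<Sum>i\<in>I. (f i u v)\<^sup>2"
  assumes bil: "\<And>i. i \<in> I \<Longrightarrow> bounded_bilinear (f i)"
    and K: "\<And>u v. Q u v \<le> K * (norm u)\<^sup>2 * (norm v)\<^sup>2" "0 \<le> K"
    and u: "norm u = 1" "norm u' = 1" "dist u u' \<le> \<epsilon>"
    and v: "norm v = 1" "norm v' = 1" "dist v v' \<le> \<epsilon>" and "0 < \<epsilon>"
  shows "\<bar>Q u v - Q u' v'\<bar> \<le> 4 * \<epsilon> * K"
proof -
  have "\<bar>Q u v - Q u' v\<bar> \<le> 2 * \<epsilon> * K"
    using assms unfolding Q_def by (intro bilinear_square_diff_left) auto
  moreover have "\<bar>Q u' v - Q u' v'\<bar> \<le> 2 * \<epsilon> * K"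
    using bilinear_square_diff_left [of I "\<lambda>i v u. f i u v" K v v' u' \<epsilon>] assms
    by (simp add: bounded_bilinear.flip mult.commute mult.left_commute)
  ultimately show ?thesis by linarith
qed

text \<open>
  Let \<open>K\<close> be the maximum of \<open>Q\<close> over pairs of unit vectors. Moving from a maximiser to the nearest net
  points changes \<open>Q\<close> by at most \<open>4 * \<epsilon> * K\<close>, so \<open>K \<le> b + 4 * \<epsilon> * K\<close>, which bounds \<open>K\<close> in terms of \<open>b\<close>
  alone. With \<open>K\<close> under control, the same comparison gives the lower bound. Arbitrary vectors follow by
  homogeneity.
\<close>

lemma bilinear_square_net_bounds:
  fixes I :: "'i set" and f :: "'i \<Rightarrow> 'a::euclidean_space \<Rightarrow> 'b::euclidean_space \<Rightarrow> real"
  defines "Q \<equiv> \<lambda>u v. \<Sum>i\<in>I. (f i u v)\<^sup>2"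
  assumes bil: "\<And>i. i \<in> I \<Longrightarrow> bounded_bilinear (f i)"
    and N: "finite_net \<epsilon> (sphere 0 1) N" and N': "finite_net \<epsilon> (sphere 0 1) N'"
    and \<epsilon>: "0 < \<epsilon>" "4 * \<epsilon> < 1"
    and ab: "\<And>u v. u \<in> N \<Longrightarrow> v \<in> N' \<Longrightarrow> a \<le> Q u v \<and> Q u v \<le> b"
  shows "Q u v \<le> b / (1 - 4 * \<epsilon>) * (norm u)\<^sup>2 * (norm v)\<^sup>2"
    and "(a - 4 * \<epsilon> * (b / (1 - 4 * \<epsilon>))) * (norm u)\<^sup>2 * (norm v)\<^sup>2 \<le> Q u v"
proof -
  have scale: "Q u v = Q (u /\<^sub>R norm u) (v /\<^sub>R norm v) * (norm u)\<^sup>2 * (norm v)\<^sup>2" for u v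
  proof -
    have "(f i u v)\<^sup>2 = (f i (u /\<^sub>R norm u) (v /\<^sub>R norm v))\<^sup>2 * (norm u)\<^sup>2 * (norm v)\<^sup>2" if "i \<in> I" for i
      using bil [OF that]
      by (cases "u = 0 \<or> v = 0")
        (auto simp: bounded_bilinear.scaleR_left bounded_bilinear.scaleR_right
          bounded_bilinear.zero_left bounded_bilinear.zero_right power_mult_distrib field_simps)
    then show ?thesis by (simp add: Q_def sum_distrib_right)
  qed
  have cont: "continuous_on (sphere 0 1 \<times> sphere 0 1) (\<lambda>(u, v). Q u v)"
    unfolding Q_def case_prod_unfold
    by (intro continuous_intros bounded_bilinear.continuous_on [OF bil]) auto
  have "sphere (0::'a) 1 \<times> sphere (0::'b) 1 \<noteq> {}" by simp
  moreover have "compact (sphere (0::'a) 1 \<times> sphere (0::'b) 1)" by (intro compact_Times) auto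
  ultimately obtain u0 v0 where uv0: "norm u0 = 1" "norm v0 = 1"
      and max: "\<And>u v. norm u = 1 \<Longrightarrow> norm v = 1 \<Longrightarrow> Q u v \<le> Q u0 v0"
    using continuous_attains_sup [OF _ _ cont] by force
  define K where "K = Q u0 v0"
  have K0: "0 \<le> K" by (auto simp: K_def Q_def intro!: sum_nonneg)
  have K: "Q u v \<le> K * (norm u)\<^sup>2 * (norm v)\<^sup>2" for u v
  proof (cases "u = 0 \<or> v = 0")
    case False
    then have "Q (u /\<^sub>R norm u) (v /\<^sub>R norm v) \<le> K"
      unfolding K_def by (intro max) auto
    then show ?thesis
      by (subst scale) (intro mult_right_mono, auto)
  qed (subst scale, auto)
  have near: "\<exists>u'\<in>N. \<exists>v'\<in>N'. \<bar>Q u v - Q u' v'\<bar> \<le> 4 * \<epsilon> * K" if "norm u = 1" "norm v = 1" for u v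
  proof -
    obtain u' v' where *: "u' \<in> N" "dist u u' \<le> \<epsilon>" "v' \<in> N'" "dist v v' \<le> \<epsilon>"
      using N N' \<open>norm u = 1\<close> \<open>norm v = 1\<close> unfolding finite_net_def by force
    then have "norm u' = 1" "norm v' = 1" using N N' by (auto simp: finite_net_def)
    then have "\<bar>Q u v - Q u' v'\<bar> \<le> 4 * \<epsilon> * K"
      using * that \<epsilon> K K0 unfolding Q_def by (intro bilinear_square_diff bil) auto
    then show ?thesis using * by blast
  qed
  have "K \<le> b + 4 * \<epsilon> * K"
    using near [OF uv0] ab unfolding K_def by fastforce
  then have Kb: "K \<le> b / (1 - 4 * \<epsilon>)"
    using \<epsilon> by (simp add: field_simps)
  have "Q u v \<le> K * (norm u)\<^sup>2 * (norm v)\<^sup>2" by (rule K)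
  also have "\<dots> \<le> b / (1 - 4 * \<epsilon>) * (norm u)\<^sup>2 * (norm v)\<^sup>2"
    by (intro mult_right_mono Kb) auto
  finally show "Q u v \<le> b / (1 - 4 * \<epsilon>) * (norm u)\<^sup>2 * (norm v)\<^sup>2" .
  show "(a - 4 * \<epsilon> * (b / (1 - 4 * \<epsilon>))) * (norm u)\<^sup>2 * (norm v)\<^sup>2 \<le> Q u v"
  proof (cases "u = 0 \<or> v = 0")
    case False
    then have *: "norm (u /\<^sub>R norm u) = 1" "norm (v /\<^sub>R norm v) = 1" by auto
    have "4 * \<epsilon> * K \<le> 4 * \<epsilon> * (b / (1 - 4 * \<epsilon>))"
      using Kb \<epsilon> by (intro mult_left_mono) auto
    then have "a - 4 * \<epsilon> * (b / (1 - 4 * \<epsilon>)) \<le> Q (u /\<^sub>R norm u) (v /\<^sub>R norm v)"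
      using near [OF *] ab by fastforce
    then show ?thesis by (subst scale) (intro mult_right_mono, auto)
  qed (subst scale, auto)
qed

section \<open>Uniform bounds for random symmetric forms\<close>

text \<open>
  An event that quantifies over uncountably many parameters is measurable if the constraint is continuous
  in the parameter, because then a countable dense set of parameters suffices.
\<close>

lemma measurable_forall_nonneg:
  fixes g :: "'a::second_countable_topology \<Rightarrow> 'w \<Rightarrow> real"
  assumes meas: "\<And>x. g x \<in> borel_measurable M"
    and cont: "\<And>w. w \<in> space M \<Longrightarrow> continuous_on UNIV (\<lambda>x. g x w)"
  shows "{w \<in> space M. \<forall>x. 0 \<le> g x w} \<in> sets M"
proof -
  obtain D :: "'a set" where D: "countable D" "\<And>U. open U \<Longrightarrow> U \<noteq> {} \<Longrightarrow> \<exists>d\<in>D. d \<in> U"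
    using countable_dense_exists by blast
  have "{w \<in> space M. \<forall>x. 0 \<le> g x w} = {w \<in> space M. \<forall>x\<in>D. 0 \<le> g x w}"
  proof (intro Collect_cong conj_cong refl iffI)
    fix w assume w: "w \<in> space M" and *: "\<forall>x\<in>D. 0 \<le> g x w"
    have "open {x. g x w < 0}"
      using cont [OF w] by (intro open_Collect_less continuous_intros)
    then have "{x. g x w < 0} = {}"
      using D(2) [of "{x. g x w < 0}"] * by fastforce
    then show "\<forall>x. 0 \<le> g x w" by (auto simp: not_less [symmetric])
  qed auto
  also have "\<dots> \<in> sets M"
  proof (rule sets.sets_Collect_countable_All' [OF _ D(1)])
    show "{w \<in> space M. 0 \<le> g x w} \<in> sets M" for x
      using meas [of x] by measurable
  qed
  finally show ?thesis .
qed

text \<open>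
  For a net of mesh \<open>\<gamma> / 12\<close> with \<open>k\<close> points in dimension \<open>p\<close>, a union bound over pairs costs a factor
  \<open>k * k \<le> (36 * sqrt 2 / \<gamma>) ^ (2 * p)\<close>. The assumption on \<open>x\<close> makes this at most \<open>exp x\<close>, that is,
  half of the exponent available for a single pair pays for the whole net.
\<close>

lemma net_union_bound:
  fixes \<gamma> x :: real
  assumes "0 < \<gamma>" "\<gamma> < 1 / 3" and card: "real k \<le> (1 + 2 / (\<gamma> / 12)) ^ p"
    and x: "ln (36 * sqrt 2 / \<gamma>) * (2 * real p + 1) \<le> x"
  shows "real (k * k) * (2 * exp (- (2 * x))) \<le> 2 * exp (- x)"
proof -
  define L where "L = ln (36 * sqrt 2 / \<gamma>)"
  have s2: "1 \<le> sqrt 2" by simp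
  have eL: "exp L = 36 * sqrt 2 / \<gamma>" using assms by (simp add: L_def)
  have "1 + 2 / (\<gamma> / 12) \<le> 36 / \<gamma>" using assms by (simp add: field_simps)
  also have "\<dots> \<le> exp L" unfolding eL using s2 assms by (intro divide_right_mono) auto
  finally have le: "1 + 2 / (\<gamma> / 12) \<le> exp L" .
  have "1 \<le> 1 + 2 / (\<gamma> / 12)" using assms by simp
  with le have L0: "0 \<le> L" using one_le_exp_iff order_trans by blast
  have "real k \<le> exp L ^ p"
    using card le assms by (meson add_nonneg_nonneg divide_nonneg_nonneg order_trans power_mono less_imp_le zero_le_numeral zero_le_one)
  then have "real k * real k \<le> exp L ^ p * exp L ^ p"
    by (intro mult_mono) auto
  also have "\<dots> = exp (2 * real p * L)"
    by (simp add: exp_of_nat_mult [symmetric] exp_add [symmetric])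
  also have "\<dots> \<le> exp x" using x L0 by (simp add: L_def algebra_simps)
  finally have "real (k * k) * (2 * exp (- (2 * x))) \<le> exp x * (2 * exp (- (2 * x)))"
    by (intro mult_right_mono) auto
  also have "\<dots> = 2 * exp (- x)" by (simp add: exp_add [symmetric])
  finally show ?thesis .
qed

theorem lemma2p2:
  fixes M :: "'w measure"
    and n :: nat
    and B A :: "nat \<Rightarrow> 'w \<Rightarrow> real^'p^'p"
    and \<rho> \<sigma> \<gamma> p4 :: real
  assumes M: "prob_space M"
    and rho: "\<rho>\<^sup>2 > 0"
    and sigma: "\<sigma>\<^sup>2 > 0"
    and indep: "prob_space.indep_vars M (\<lambda>_. borel) B {1..n}"
    and subgaussian: "\<And>i. i \<in> {1..n} \<Longrightarrow> subgaussian_mat M (B i) (\<rho>\<^sup>2)"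
    and iid: "\<And>i. i \<in> {1..n} \<Longrightarrow> iid_vars M (\<lambda>(j, k) w. B i w $ j $ k) UNIV"
    and mean: "\<And>i j k. i \<in> {1..n} \<Longrightarrow> prob_space.expectation M (\<lambda>w. B i w $ j $ k) = 0"
    and variance: "\<And>i j k. i \<in> {1..n} \<Longrightarrow> prob_space.variance M (\<lambda>w. B i w $ j $ k) = \<sigma>\<^sup>2"
    and A: "\<And>i w. i \<in> {1..n} \<Longrightarrow> w \<in> space M \<Longrightarrow>
              A i w = (1 / 2) *\<^sub>R (B i w + transpose (B i w))"
    and gamma: "0 < \<gamma>" "\<gamma> < 1 / 3"
    and n: "real n \<ge> 4096 * ln (36 * sqrt 2 / \<gamma>) * \<rho> ^ 4 / (\<gamma>\<^sup>2 * \<sigma> ^ 4)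
                        * (2 * real CARD('p) + 1)"
    and p4: "p4 = 2 * exp (- (real n * \<gamma>\<^sup>2 * \<sigma> ^ 4 / (4096 * \<rho> ^ 4)))"
  shows "measure M {w \<in> space M. \<forall>u v :: real^'p.
            (1 - 2 * \<gamma>) / 2 * \<sigma>\<^sup>2 * (norm u)\<^sup>2 * (norm v)\<^sup>2
              \<le> (1 / real n) * (\<Sum>i=1..n. (u \<bullet> (A i w *v v))\<^sup>2) \<and>
            (1 / real n) * (\<Sum>i=1..n. (u \<bullet> (A i w *v v))\<^sup>2)
              \<le> (2 + 3 * \<gamma>) / 2 * \<sigma>\<^sup>2 * (norm u)\<^sup>2 * (norm v)\<^sup>2} \<ge> 1 - p4
       \<and> (\<exists>l>0. \<exists>e>0. measure M {w \<in> space M. \<forall>u v :: real^'p.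
            l * (norm u)\<^sup>2 * (norm v)\<^sup>2
              \<le> (1 / real n) * (\<Sum>i=1..n. (u \<bullet> (A i w *v v))\<^sup>2) \<and>
            (1 / real n) * (\<Sum>i=1..n. (u \<bullet> (A i w *v v))\<^sup>2)
              \<le> e * (norm u)\<^sup>2 * (norm v)\<^sup>2} \<ge> 1 - p4)"
proof -
  interpret prob_space M by fact
  define L where "L = (1 - 2 * \<gamma>) / 2 * \<sigma>\<^sup>2"
  define U where "U = (2 + 3 * \<gamma>) / 2 * \<sigma>\<^sup>2"
  define Q where "Q = (\<lambda>w u v. \<Sum>i=1..n. (u \<bullet> (A i w *v v))\<^sup>2)"
  define S where "S = {w \<in> space M. \<forall>u v. L * (norm u)\<^sup>2 * (norm v)\<^sup>2 \<le> (1 / real n) * Q w u v \<and>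
            (1 / real n) * Q w u v \<le> U * (norm u)\<^sup>2 * (norm v)\<^sup>2}"
  have LU: "0 < L" "0 < U" using gamma sigma by (auto simp: L_def U_def)

  define x where "x = real n * \<gamma>\<^sup>2 * \<sigma> ^ 4 / (4096 * \<rho> ^ 4)"
  have [simp]: "\<rho> \<noteq> 0" "\<sigma> \<noteq> 0" using rho sigma by auto
  have x: "ln (36 * sqrt 2 / \<gamma>) * (2 * real CARD('p) + 1) \<le> x"
    using n gamma by (simp add: x_def field_simps)
  have "1 \<le> sqrt 2" by simp
  then have "\<gamma> < 36 * sqrt 2" using gamma by linarith
  then have "1 < 36 * sqrt 2 / \<gamma>" using gamma by simp
  then have "0 < ln (36 * sqrt 2 / \<gamma>) * (2 * real CARD('p) + 1)" by simp
  with x have "0 < x" by linarith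
  then have n0: "0 < n" by (cases n) (auto simp: x_def)

  define X where "X = (\<lambda>i u v w. (u \<bullet> (B i w *v v) + v \<bullet> (B i w *v u)) / 2)"
  have AX: "u \<bullet> (A i w *v v) = X i u v w" if "i \<in> {1..n}" "w \<in> space M" for i u v w
    unfolding A [OF that] symmetric_part_form X_def ..
  have QX: "Q w u v = (\<Sum>i=1..n. (X i u v w)\<^sup>2)" if "w \<in> space M" for w u v
    unfolding Q_def using AX that by simp
  have form_cont: "continuous_on UNIV (\<lambda>X. (u \<bullet> (X *v v) + v \<bullet> (X *v u)) / 2)" for u v :: "real^'p"
    unfolding matrix_vector_mult_def inner_vec_def by (intro continuous_intros) simp_all
  have indX: "indep_vars (\<lambda>_. borel) (\<lambda>i w. X i u v w) {1..n}" for u v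
    unfolding X_def
    by (rule indep_vars_compose2 [OF indep, where Y = "\<lambda>_ X. (u \<bullet> (X *v v) + v \<bullet> (X *v u)) / 2"])
       (rule borel_measurable_continuous_onI [OF form_cont])
  have measX: "X i u v \<in> borel_measurable M" if "i \<in> {1..n}" for i u v
    using indX [of u v] that by (auto simp: indep_vars_def)
  have measQ [measurable]: "(\<lambda>w. Q w u v) \<in> borel_measurable M" for u v
  proof -
    have "(\<lambda>w. \<Sum>i=1..n. (X i u v w)\<^sup>2) \<in> borel_measurable M"
      using measX by measurable
    then show ?thesis by (simp cong: measurable_cong add: QX)
  qed
  have contQ: "continuous_on UNIV (\<lambda>(u, v). Q w u v)" for w
    unfolding Q_def case_prod_unfold
    by (intro continuous_intros bounded_bilinear.continuous_on [OF bounded_bilinear_matrix_form])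
  \<comment> \<open>Without measurability the event would have measure \<open>0\<close> by convention, so it must be shown first.\<close>
  have S_sets: "S \<in> sets M"
  proof -
    have "{w \<in> space M. \<forall>z. 0 \<le> (case z of (u, v) \<Rightarrow> (1 / real n) * Q w u v - L * (norm u)\<^sup>2 * (norm v)\<^sup>2)} \<in> sets M"
      using contQ n0
      by (intro measurable_forall_nonneg) (auto simp: case_prod_unfold intro!: continuous_intros)
    moreover have "{w \<in> space M. \<forall>z. 0 \<le> (case z of (u, v) \<Rightarrow> U * (norm u)\<^sup>2 * (norm v)\<^sup>2 - (1 / real n) * Q w u v)} \<in> sets M"
      using contQ n0
      by (intro measurable_forall_nonneg) (auto simp: case_prod_unfold intro!: continuous_intros)
    moreover have "S = {w \<in> space M. \<forall>z. 0 \<le> (case z of (u, v) \<Rightarrow> (1 / real n) * Q w u v - L * (norm u)\<^sup>2 * (norm v)\<^sup>2)}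
        \<inter> {w \<in> space M. \<forall>z. 0 \<le> (case z of (u, v) \<Rightarrow> U * (norm u)\<^sup>2 * (norm v)\<^sup>2 - (1 / real n) * Q w u v)}"
      by (auto simp: S_def)
    ultimately show ?thesis by (simp only: sets.Int)
  qed

  define \<mu> where "\<mu> = (\<lambda>u v :: real^'p. \<sigma>\<^sup>2 * ((norm u)\<^sup>2 * (norm v)\<^sup>2 + (u \<bullet> v)\<^sup>2) / 2)"
  have moment: "(\<integral>w. (X i u v w)\<^sup>2 \<partial>M) = \<mu> u v" if "i \<in> {1..n}" for i u v
    unfolding X_def \<mu>_def
    using symmetric_part_second_moment [OF M subgaussian [OF that] rho iid [OF that] variance mean] that
    by simp
  have sgX: "subgaussian_var M (X i u v) (\<rho>\<^sup>2)" if "i \<in> {1..n}" "norm u = 1" "norm v = 1" for i u v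
    using subgaussian [OF that(1)] that unfolding X_def subgaussian_mat_def
    by (intro subgaussian_var_average) auto
  have mu_bounds: "\<sigma>\<^sup>2 / 2 \<le> \<mu> u v" "\<mu> u v \<le> \<sigma>\<^sup>2" if "norm u = 1" "norm v = 1" for u v
  proof -
    have "\<bar>u \<bullet> v\<bar> \<le> 1" using Cauchy_Schwarz_ineq2 [of u v] that by simp
    then have "(u \<bullet> v)\<^sup>2 \<le> 1" by (simp add: abs_square_le_1)
    then show "\<sigma>\<^sup>2 / 2 \<le> \<mu> u v" "\<mu> u v \<le> \<sigma>\<^sup>2"
      using that by (auto simp: \<mu>_def field_simps)
  qed
  obtain e :: "real^'p" where e: "norm e = 1" using vector_choose_size [of 1] by auto
  have sr: "\<sigma>\<^sup>2 \<le> 4 * \<rho>\<^sup>2"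
    using subgaussian_second_moment [OF M sgX rho, of 1 e e] moment [of 1 e e] mu_bounds [OF e e] n0 e
    by simp

  \<comment> \<open>Half of the relative error \<open>\<gamma>\<close> is allowed to each net point; the rest covers the distance to the net.\<close>
  define t where "t = \<gamma> * \<sigma>\<^sup>2 / 2"
  obtain N :: "(real^'p) set" where N: "finite_net (\<gamma> / 12) (sphere 0 1) N"
      and cardN: "real (card N) \<le> (1 + 2 / (\<gamma> / 12)) ^ CARD('p)"
    using sphere_net [of "\<gamma> / 12"] gamma by (metis DIM_cart DIM_real divide_pos_pos mult.right_neutral zero_less_numeral)
  define Bad where "Bad = (\<lambda>(u, v). {w \<in> space M. \<bar>Q w u v - real n * \<mu> u v\<bar> \<ge> real n * t})"
  have Bad_sets [measurable]: "Bad z \<in> sets M" for z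
    by (cases z) (simp add: Bad_def)
  have Bad_prob: "measure M (Bad z) \<le> 2 * exp (- (2 * x))" if "z \<in> N \<times> N" for z
  proof -
    obtain u v where uv: "z = (u, v)" by fastforce
    have "u \<in> N" "v \<in> N" using \<open>z \<in> N \<times> N\<close> uv by auto
    then have z: "z = (u, v)" "norm u = 1" "norm v = 1"
      using N uv by (auto simp: finite_net_def)
    have t: "0 \<le> t" "t \<le> 16 * \<rho>\<^sup>2"
    proof -
      show "0 \<le> t" using gamma by (simp add: t_def)
      have "\<gamma> * \<sigma>\<^sup>2 \<le> 1 * (4 * \<rho>\<^sup>2)" using gamma sr by (intro mult_mono) auto
      then show "t \<le> 16 * \<rho>\<^sup>2" using rho unfolding t_def by linarith
    qed
    have "Bad z = {w \<in> space M. real (card {1..n}) * t \<le>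
        \<bar>(\<Sum>i\<in>{1..n}. (X i u v w)\<^sup>2) - real (card {1..n}) * \<mu> u v\<bar>}"
      by (auto simp: z Bad_def QX)
    then have "measure M (Bad z) \<le> 2 * exp (- (real (card {1..n}) * t\<^sup>2 / (512 * (\<rho>\<^sup>2)\<^sup>2)))"
      using subgaussian_squares_concentration [OF M _ indX sgX rho moment t] z by simp
    also have "real (card {1..n}) * t\<^sup>2 / (512 * (\<rho>\<^sup>2)\<^sup>2) = 2 * x"
      by (simp add: x_def t_def power_divide power_mult_distrib power_mult [symmetric])
    finally show ?thesis .
  qed
  have finN: "finite N" using N by (simp add: finite_net_def)
  have "measure M (\<Union>z\<in>N \<times> N. Bad z) \<le> (\<Sum>z\<in>N \<times> N. measure M (Bad z))"
    using finN by (intro measure_UNION_le) auto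
  also have "\<dots> \<le> (\<Sum>z\<in>N \<times> N. 2 * exp (- (2 * x)))"
    by (intro sum_mono Bad_prob)
  also have "\<dots> = real (card N * card N) * (2 * exp (- (2 * x)))"
    by (simp add: card_cartesian_product)
  also have "\<dots> \<le> p4"
    unfolding p4 x_def [symmetric] by (rule net_union_bound [OF gamma cardN x])
  finally have Bad_le: "measure M (\<Union>z\<in>N \<times> N. Bad z) \<le> p4" .

  have good: "space M - (\<Union>z\<in>N \<times> N. Bad z) \<subseteq> S"
  proof
    fix w assume w: "w \<in> space M - (\<Union>z\<in>N \<times> N. Bad z)"
    \<comment> \<open>The bounds for \<open>\<mu>\<close> on unit vectors, \<open>\<sigma>\<^sup>2 / 2\<close> and \<open>\<sigma>\<^sup>2\<close>, each widened by \<open>t\<close> and multiplied by \<open>n\<close>.\<close>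
    define a b where "a = real n * (\<sigma>\<^sup>2 * (1 - \<gamma>) / 2)" and "b = real n * (\<sigma>\<^sup>2 * (1 + \<gamma> / 2))"
    have ab: "a \<le> Q w u v \<and> Q w u v \<le> b" if "u \<in> N" "v \<in> N" for u v
    proof -
      have "\<bar>Q w u v - real n * \<mu> u v\<bar> \<le> real n * t"
        using w that by (fastforce simp: Bad_def)
      moreover have "norm u = 1" "norm v = 1" using that N by (auto simp: finite_net_def)
      then have "real n * (\<sigma>\<^sup>2 / 2) \<le> real n * \<mu> u v" "real n * \<mu> u v \<le> real n * \<sigma>\<^sup>2"
        using mu_bounds [of u v] by (simp_all only: mult_left_mono of_nat_0_le_iff)
      moreover have "real n * (\<sigma>\<^sup>2 / 2) - real n * t = a" "real n * \<sigma>\<^sup>2 + real n * t = b"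
        by (auto simp: a_def b_def t_def field_simps)
      ultimately show ?thesis by linarith
    qed
    note bounds = bilinear_square_net_bounds [of "{1..n}" "\<lambda>i u v. u \<bullet> (A i w *v v)",
        OF bounded_bilinear_matrix_form N N _ _ ab [unfolded Q_def]]
    have up: "b / (1 - 4 * (\<gamma> / 12)) \<le> real n * U"
    proof -
      have "0 \<le> \<gamma> * (4 / 3 - \<gamma>)" using gamma by (intro mult_nonneg_nonneg) auto
      then have "1 + \<gamma> / 2 \<le> (2 + 3 * \<gamma>) / 2 * (1 - \<gamma> / 3)"
        by (simp add: algebra_simps)
      then have "(1 + \<gamma> / 2) / (1 - \<gamma> / 3) \<le> (2 + 3 * \<gamma>) / 2"
        using gamma by (subst pos_divide_le_eq) auto
      then have "real n * \<sigma>\<^sup>2 * ((1 + \<gamma> / 2) / (1 - \<gamma> / 3)) \<le> real n * \<sigma>\<^sup>2 * ((2 + 3 * \<gamma>) / 2)"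
        by (intro mult_left_mono) auto
      then show ?thesis by (simp add: b_def U_def mult_ac)
    qed
    have low: "real n * L \<le> a - 4 * (\<gamma> / 12) * (b / (1 - 4 * (\<gamma> / 12)))"
    proof -
      have "4 * (\<gamma> / 12) * (b / (1 - 4 * (\<gamma> / 12))) \<le> 4 * (\<gamma> / 12) * (real n * U)"
        using up gamma by (intro mult_left_mono) auto
      also have "\<dots> = real n * \<sigma>\<^sup>2 * (\<gamma> / 3 * ((2 + 3 * \<gamma>) / 2))"
        by (simp add: U_def)
      also have "\<dots> \<le> real n * \<sigma>\<^sup>2 * (\<gamma> / 3 * (3 / 2))"
        using gamma by (intro mult_left_mono) auto
      also have "\<dots> = a - real n * L" by (simp add: a_def L_def field_simps)
      finally show ?thesis by linarith
    qed
    have "real n * L * (norm u)\<^sup>2 * (norm v)\<^sup>2 \<le> Q w u v \<and> Q w u v \<le> real n * U * (norm u)\<^sup>2 * (norm v)\<^sup>2" for u v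
    proof
      have "real n * L * (norm u)\<^sup>2 * (norm v)\<^sup>2 \<le>
          (a - 4 * (\<gamma> / 12) * (b / (1 - 4 * (\<gamma> / 12)))) * (norm u)\<^sup>2 * (norm v)\<^sup>2"
        by (intro mult_right_mono low) auto
      also have "\<dots> \<le> Q w u v"
        unfolding Q_def using gamma by (intro bounds(2)) auto
      finally show "real n * L * (norm u)\<^sup>2 * (norm v)\<^sup>2 \<le> Q w u v" .
      have "Q w u v \<le> b / (1 - 4 * (\<gamma> / 12)) * (norm u)\<^sup>2 * (norm v)\<^sup>2"
        unfolding Q_def using gamma by (intro bounds(1)) auto
      also have "\<dots> \<le> real n * U * (norm u)\<^sup>2 * (norm v)\<^sup>2"
        by (intro mult_right_mono up) auto
      finally show "Q w u v \<le> real n * U * (norm u)\<^sup>2 * (norm v)\<^sup>2" .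
    qed
    then show "w \<in> S"
      using w n0 by (simp add: S_def field_simps)
  qed
  have "1 - p4 \<le> measure M (space M - (\<Union>z\<in>N \<times> N. Bad z))"
    using Bad_le finN by (subst prob_compl) auto
  also have "\<dots> \<le> measure M S"
    by (intro finite_measure_mono good S_sets)
  finally have main: "1 - p4 \<le> measure M S" .
  show ?thesis
    using main LU unfolding S_def L_def U_def Q_def by blast
qed

end
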